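(* Let $W\ge 1$ be an integer and $0<\varepsilon<1$ be such that $W\varepsilon^{-1}=2^L$ for an integer $L$. Consider a window consisting of the last $W$ items of a stream over a universe of IDs; for an ID $y$ let $f^W_y$ be its number of occurrences in the window, and let $\mathcal D$ be the set of distinct IDs in the window. Let $h$ be a random fingerprint function mapping IDs to $\{0,1,\dots,2^L-1\}$ such that the fingerprints of distinct IDs are independent and uniformly distributed; let $F=\{h(y):y\in\mathcal D\}$ and for $g\in F$ let $n_g$ be the number of items in the window whose fingerprint is $g$. Define $$H=-\sum_{y\in\mathcal D}\frac{f^W_y}{W}\ln\frac{f^W_y}{W},\qquad \hat H=-\sum_{g\in F}\frac{n_g}{W}\ln\frac{n_g}{W}.$$ Let $0<\delta\le 1$ and $\varepsilon_H=\varepsilon\delta^{-1}$. Then $\hat H$ solves the $(W,\varepsilon_H,\delta)$-Entropy Estimation problem, that is, $\hat H\le H$ always and $$\Pr\left(H-\hat H\ge\varepsilon_H\right)\le\delta.$$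
   Context: $H$ is the entropy of the window's ID distribution and $\hat H$ is the estimator returned by the Entropy query of the SWAMP algorithm. *)

theory Defs
  imports "HOL-Probability.Probability"
begin

definition last_items :: "nat \<Rightarrow> 'id list \<Rightarrow> 'id list" where
  "last_items W s = drop (length s - W) s"

definition window_entropy :: "nat \<Rightarrow> 'id list \<Rightarrow> real" where
  "window_entropy W w =
     - (\<Sum>y\<in>set w. real (count_list w y) / real W * ln (real (count_list w y) / real W))"

definition fingerprint_count :: "('id \<Rightarrow> nat) \<Rightarrow> 'id list \<Rightarrow> nat \<Rightarrow> nat" where
  "fingerprint_count h w g = length (filter (\<lambda>y. h y = g) w)"

definition swamp_entropy :: "nat \<Rightarrow> ('id \<Rightarrow> nat) \<Rightarrow> 'id list \<Rightarrow> real" where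
  "swamp_entropy W h w =
     - (\<Sum>g\<in>h ` set w. real (fingerprint_count h w g) / real W
                       * ln (real (fingerprint_count h w g) / real W))"

context prob_space
begin

text \<open>
  Mutual independence over all IDs; \<^term>\<open>h y\<close> is the random fingerprint of the ID \<^term>\<open>y\<close>.
\<close>

definition uniform_fingerprints :: "nat \<Rightarrow> ('id \<Rightarrow> 'a \<Rightarrow> nat) \<Rightarrow> bool" where
  "uniform_fingerprints L h \<longleftrightarrow>
     indep_vars (\<lambda>_. count_space {0..<2 ^ L}) h UNIV \<and>
     (\<forall>y. distr M (count_space {0..<2 ^ L}) (h y) = uniform_count_measure {0..<2 ^ L})"

text \<open>
  Measurability of the estimator is part of the notion because \<^const>\<open>prob\<close> returns \<open>0\<close> on
  non-measurable sets, which would make the probability bound void.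
\<close>

definition solves_entropy_estimation ::
    "nat \<Rightarrow> real \<Rightarrow> real \<Rightarrow> 'id list \<Rightarrow> ('a \<Rightarrow> real) \<Rightarrow> bool" where
  "solves_entropy_estimation W \<epsilon> \<delta> w X \<longleftrightarrow>
     random_variable borel X \<and>
     (\<forall>\<omega>\<in>space M. X \<omega> \<le> window_entropy W w) \<and>
     prob {\<omega> \<in> space M. window_entropy W w - X \<omega> \<ge> \<epsilon>} \<le> \<delta>"

end

end

theory Submission
  imports Defs
begin

text \<open>
  Writing \<open>f\<close> for the multiplicities of the IDs, both entropies are sums over the distinct IDs, and
  \<open>H - H' = (\<Sum>y. f y / W * ln (n (h y) / f y))\<close>. Each term is nonnegative, and \<open>ln x \<le> x - 1\<close>
  bounds the sum by \<open>1 / W\<close> times the total multiplicity of colliding IDs \<open>y' \<noteq> y\<close>, summed over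
  all \<open>y\<close>. Distinct IDs collide with probability \<open>1 / 2 ^ L\<close>, so the expected error is at most
  \<open>W / 2 ^ L = \<epsilon>\<close>, and Markov's inequality concludes.
\<close>

text \<open>Group the filtered list by ID. The conditional summand keeps the index set
  \<open>set w\<close> independent of \<open>h\<close>, which suits both splitting off a single ID
  and measurability in a random \<open>h\<close>.\<close>

lemma fingerprint_count_eq_sum:
  "fingerprint_count h w g = (\<Sum>y\<in>set w. if h y = g then count_list w y else 0)"
proof -
  have "fingerprint_count h w g = (\<Sum>y\<in>set (filter (\<lambda>y. h y = g) w). count_list (filter (\<lambda>y. h y = g) w) y)"
    unfolding fingerprint_count_def by (rule sum_count_set[symmetric]) auto
  also have "\<dots> = (\<Sum>y\<in>{y\<in>set w. h y = g}. count_list w y)"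
    by (rule sum.cong) (auto simp: count_list_eq_length_filter intro!: arg_cong[where f=length] filter_cong)
  also have "\<dots> = (\<Sum>y\<in>set w. if h y = g then count_list w y else 0)"
    by (rule sum.inter_filter) simp
  finally show ?thesis .
qed

lemma count_list_le_fingerprint_count: "count_list w y \<le> fingerprint_count h w (h y)"
  unfolding fingerprint_count_def count_list_eq_length_filter
  by (induction w) auto

text \<open>The logarithm is constant on each fibre of \<open>h\<close>, and the multiplicities in a
  fibre add up to its fingerprint count. This gives both entropies the same index set, so they can
  be subtracted term by term.\<close>

lemma swamp_entropy_eq_sum_IDs:
  "swamp_entropy W h w =
     - (\<Sum>y\<in>set w. real (count_list w y) / real W * ln (real (fingerprint_count h w (h y)) / real W))"
proof -
  let ?\<phi> = "\<lambda>g. ln (real (fingerprint_count h w g) / real W)"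
  have "(\<Sum>y\<in>set w. real (count_list w y) / real W * ?\<phi> (h y))
      = (\<Sum>g\<in>h ` set w. \<Sum>y\<in>{y\<in>set w. h y = g}. real (count_list w y) / real W * ?\<phi> (h y))"
    by (rule sum.image_gen) simp
  also have "\<dots> = (\<Sum>g\<in>h ` set w. real (fingerprint_count h w g) / real W * ?\<phi> g)"
  proof (rule sum.cong)
    fix g
    have "(\<Sum>y\<in>{y\<in>set w. h y = g}. real (count_list w y) / real W * ?\<phi> (h y))
        = (\<Sum>y\<in>{y\<in>set w. h y = g}. real (count_list w y)) / real W * ?\<phi> g"
      by (simp add: sum_divide_distrib sum_distrib_right)
    also have "(\<Sum>y\<in>{y\<in>set w. h y = g}. real (count_list w y)) = real (fingerprint_count h w g)"
      by (simp add: fingerprint_count_eq_sum sum.inter_filter if_distrib[of real] cong: if_cong)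
    finally show "(\<Sum>y\<in>{y\<in>set w. h y = g}. real (count_list w y) / real W * ?\<phi> (h y))
        = real (fingerprint_count h w g) / real W * ?\<phi> g" .
  qed simp
  finally show ?thesis
    unfolding swamp_entropy_def by simp
qed

lemma count_list_pos: "y \<in> set w \<Longrightarrow> count_list w y > 0"
  using count_list_0_iff[of w y] by linarith

lemma entropy_deficit_eq:
  assumes "W > 0"
  shows "window_entropy W w - swamp_entropy W h w =
    (\<Sum>y\<in>set w. real (count_list w y) / real W *
       ln (real (fingerprint_count h w (h y)) / real (count_list w y)))"
proof -
  have "real (count_list w y) / real W * ln (real (fingerprint_count h w (h y)) / real W)
      - real (count_list w y) / real W * ln (real (count_list w y) / real W)
      = real (count_list w y) / real W * ln (real (fingerprint_count h w (h y)) / real (count_list w y))"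
    if "y \<in> set w" for y
    \<comment> \<open>Positivity of both counts and of \<open>W\<close> licenses
      \<open>ln_div\<close>; the two copies of \<open>ln W\<close> then cancel.\<close>
    using count_list_pos[OF that] count_list_le_fingerprint_count[of w y h] assms
    by (simp add: ln_div right_diff_distrib)
  then show ?thesis
    unfolding swamp_entropy_eq_sum_IDs window_entropy_def
    by (simp add: sum_subtractf[symmetric])
qed

text \<open>Merging IDs only enlarges counts, so every ratio inside a logarithm of the deficit is at
  least 1.\<close>

lemma swamp_entropy_le_window_entropy:
  assumes "W > 0"
  shows "swamp_entropy W h w \<le> window_entropy W w"
proof -
  have "0 \<le> ln (real (fingerprint_count h w (h y)) / real (count_list w y))" if "y \<in> set w" for y
    using count_list_pos[OF that] count_list_le_fingerprint_count[of w y h]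
    by (intro ln_ge_zero) simp
  then have "0 \<le> window_entropy W w - swamp_entropy W h w"
    unfolding entropy_deficit_eq[OF assms] by (intro sum_nonneg mult_nonneg_nonneg) auto
  then show ?thesis by simp
qed

text \<open>This bound is pointwise in \<open>h\<close> and linear in the indicators of pairwise
  collisions, so its mean depends only on collision probabilities of pairs.\<close>

lemma entropy_deficit_le_collisions:
  assumes "W > 0"
  shows "window_entropy W w - swamp_entropy W h w \<le>
    (\<Sum>y\<in>set w. \<Sum>z\<in>set w - {y}. real (count_list w z) * of_bool (h z = h y)) / real W"
proof -
  have "real (count_list w y) / real W * ln (real (fingerprint_count h w (h y)) / real (count_list w y))
      \<le> (\<Sum>z\<in>set w - {y}. real (count_list w z) * of_bool (h z = h y)) / real W"
    if y: "y \<in> set w" for y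
  proof -
    let ?n = "real (fingerprint_count h w (h y))" and ?f = "real (count_list w y)"
    have f: "?f > 0" and n: "?n > 0"
      using count_list_pos[OF y] count_list_le_fingerprint_count[of w y h] by auto
    have "ln (?n / ?f) \<le> ?n / ?f - 1"
      using f n by (intro ln_le_minus_one) simp
    then have "?f * ln (?n / ?f) \<le> ?f * (?n / ?f - 1)"
      using f by (intro mult_left_mono) auto
    also have "\<dots> = ?n - ?f"
      using f by (simp add: right_diff_distrib)
    \<comment> \<open>The fibre of \<open>h y\<close> contains \<open>y\<close> itself; taking out
      its share leaves the multiplicities of the other IDs in the fibre.\<close>
    also have "\<dots> = (\<Sum>z\<in>set w - {y}. real (count_list w z) * of_bool (h z = h y))"
      using y by (simp add: fingerprint_count_eq_sum sum.remove[where x = y] of_bool_def if_distrib cong: if_cong)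
    finally show ?thesis
      using assms by (simp add: divide_right_mono)
  qed
  then show ?thesis
    unfolding entropy_deficit_eq[OF assms] sum_divide_distrib by (rule sum_mono)
qed

context prob_space
begin

lemma uniform_fingerprints_measurable:
  assumes "uniform_fingerprints L h"
  shows "h y \<in> measurable M (count_space UNIV)"
proof -
  have "h y \<in> measurable M (count_space {0..<2 ^ L})"
    using assms by (simp add: uniform_fingerprints_def indep_vars_def)
  then show ?thesis
    by (rule measurable_compose) simp
qed

text \<open>Split by the common value: each of the \<open>2 ^ L\<close> values is hit by both
  fingerprints with probability \<open>(1 / 2 ^ L)\<^sup>2\<close>.\<close>

lemma uniform_fingerprints_prob_collision:
  assumes h: "uniform_fingerprints L h" and "y \<noteq> z"
  shows "prob {\<omega> \<in> space M. h z \<omega> = h y \<omega>} = 1 / 2 ^ L"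
proof -
  let ?A = "{0..<2 ^ L} :: nat set"
  have ind: "indep_vars (\<lambda>_. count_space ?A) h UNIV"
    and dist: "\<And>x. distr M (count_space ?A) (h x) = uniform_count_measure ?A"
    using h by (auto simp: uniform_fingerprints_def)
  have meas: "h x \<in> measurable M (count_space ?A)" for x
    using ind by (simp add: indep_vars_def)
  have single: "prob (h x -` {g} \<inter> space M) = 1 / 2 ^ L" if "g \<in> ?A" for x g
    using that measure_distr[OF meas, of "{g}" x]
    by (simp add: dist measure_uniform_count_measure)
  have joint: "prob (h z -` {g} \<inter> h y -` {g} \<inter> space M) = (1 / 2 ^ L)\<^sup>2" if g: "g \<in> ?A" for g
  proof -
    have "prob (\<Inter>x\<in>{y, z}. h x -` {g} \<inter> space M) = (\<Prod>x\<in>{y, z}. prob (h x -` {g} \<inter> space M))"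
      using g by (intro indep_varsD[OF ind]) auto
    also have "(\<Inter>x\<in>{y, z}. h x -` {g} \<inter> space M) = h z -` {g} \<inter> h y -` {g} \<inter> space M"
      by auto
    finally show ?thesis
      \<comment> \<open>Distinctness keeps the product over \<open>{y, z}\<close> from collapsing to
        one factor.\<close>
      using \<open>y \<noteq> z\<close> by (simp add: single[OF g] power2_eq_square)
  qed
  \<comment> \<open>Fingerprints of points of \<open>space M\<close> lie in \<open>?A\<close>, so
    finitely many values cover the event.\<close>
  have "{\<omega> \<in> space M. h z \<omega> = h y \<omega>} = (\<Union>g\<in>?A. h z -` {g} \<inter> h y -` {g} \<inter> space M)"
    using measurable_space[OF meas] by fastforce
  also have "prob \<dots> = (\<Sum>g\<in>?A. prob (h z -` {g} \<inter> h y -` {g} \<inter> space M))"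
  proof (rule finite_measure_finite_Union)
    have "h x -` {g} \<inter> space M \<in> events" if "g \<in> ?A" for x g
      using that by (intro measurable_sets[OF meas]) auto
    then have "(h z -` {g} \<inter> space M) \<inter> (h y -` {g} \<inter> space M) \<in> events" if "g \<in> ?A" for g
      using that by blast
    moreover have "(h z -` {g} \<inter> space M) \<inter> (h y -` {g} \<inter> space M) = h z -` {g} \<inter> h y -` {g} \<inter> space M" for g
      by auto
    ultimately show "(\<lambda>g. h z -` {g} \<inter> h y -` {g} \<inter> space M) ` ?A \<subseteq> events"
      by auto
  qed (auto simp: disjoint_family_on_def)
  also have "\<dots> = 1 / 2 ^ L"
    by (simp add: joint power2_eq_square)
  finally show ?thesis .
qed

lemma coincidence_event:
  fixes f g :: "'a \<Rightarrow> nat"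
  assumes [measurable]: "f \<in> measurable M (count_space UNIV)" "g \<in> measurable M (count_space UNIV)"
  shows "{\<omega> \<in> space M. f \<omega> = g \<omega>} \<in> events"
proof -
  \<comment> \<open>A countable quantifier over the common value reduces the coincidence to level
    sets of \<open>f\<close> and \<open>g\<close>.\<close>
  have "{\<omega> \<in> space M. \<exists>n. f \<omega> = n \<and> g \<omega> = n} \<in> events"
    by measurable
  then show ?thesis
    by (simp add: eq_commute)
qed

text \<open>The definition sums over the random set of occurring fingerprints. The form indexed by
  IDs has a fixed finite index set, and the counts in it are finite sums governed by coincidence
  events.\<close>

lemma swamp_entropy_measurable:
  fixes h :: "'id \<Rightarrow> 'a \<Rightarrow> nat"
  assumes h: "\<And>y. h y \<in> measurable M (count_space UNIV)"
  shows "(\<lambda>\<omega>. swamp_entropy W (\<lambda>y. h y \<omega>) w) \<in> borel_measurable M"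
proof -
  have "(\<lambda>\<omega>. real (fingerprint_count (\<lambda>y. h y \<omega>) w (h y \<omega>))) \<in> borel_measurable M" for y
    unfolding fingerprint_count_eq_sum of_nat_sum
  proof (rule borel_measurable_sum)
    fix z
    show "(\<lambda>\<omega>. real (if h z \<omega> = h y \<omega> then count_list w z else 0)) \<in> borel_measurable M"
      unfolding if_distrib[of real] by (intro measurable_If coincidence_event h) auto
  qed
  then show ?thesis
    unfolding swamp_entropy_eq_sum_IDs
    by (intro borel_measurable_uminus borel_measurable_sum borel_measurable_times borel_measurable_ln
        borel_measurable_divide borel_measurable_const)
qed

lemma expectation_entropy_deficit_le:
  assumes h: "uniform_fingerprints L h" and W: "W > 0" and len: "length w = W"
  shows "integrable M (\<lambda>\<omega>. window_entropy W w - swamp_entropy W (\<lambda>y. h y \<omega>) w)" (is "integrable M ?X")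
    and "expectation (\<lambda>\<omega>. window_entropy W w - swamp_entropy W (\<lambda>y. h y \<omega>) w) \<le> real W / 2 ^ L"
proof -
  note meas = uniform_fingerprints_measurable[OF h]
  \<comment> \<open>\<open>Y\<close> is the collision bound written with indicators of events, so
    its integral can be computed term by term.\<close>
  define Y where "Y \<omega> = (\<Sum>y\<in>set w. \<Sum>z\<in>set w - {y}.
    real (count_list w z) * indicator {\<omega> \<in> space M. h z \<omega> = h y \<omega>} \<omega>) / real W" for \<omega>
  have le: "?X \<omega> \<le> Y \<omega>" if "\<omega> \<in> space M" for \<omega>
    using entropy_deficit_le_collisions[OF W, of w "\<lambda>y. h y \<omega>"] that
    by (simp add: Y_def indicator_def)
  have nonneg: "0 \<le> ?X \<omega>" for \<omega>
    using swamp_entropy_le_window_entropy[OF W] by (simp add: algebra_simps)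
  have "has_bochner_integral M (indicator {\<omega> \<in> space M. h z \<omega> = h y \<omega>}) (1 / 2 ^ L :: real)"
    if "z \<in> set w - {y}" for y z
    using that has_bochner_integral_real_indicator[OF coincidence_event[OF meas[of z] meas[of y]]]
      uniform_fingerprints_prob_collision[OF h, of y z]
    by (auto simp: emeasure_eq_measure)
  then have "has_bochner_integral M Y
      ((\<Sum>y\<in>set w. \<Sum>z\<in>set w - {y}. real (count_list w z) * (1 / 2 ^ L)) / real W)"
    unfolding Y_def
    by (intro has_bochner_integral_divide_zero has_bochner_integral_sum has_bochner_integral_mult_right)
  then have Y: "integrable M Y"
    and EY: "expectation Y = (\<Sum>y\<in>set w. \<Sum>z\<in>set w - {y}. real (count_list w z) / 2 ^ L) / real W"
    by (simp_all add: has_bochner_integral_iff)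
  have "?X \<in> borel_measurable M"
    by (intro borel_measurable_diff borel_measurable_const
        swamp_entropy_measurable meas)
  then show X: "integrable M ?X"
  \<comment> \<open>Integrability follows by domination, since the deficit lies between 0 and
    \<open>Y\<close>.\<close>
  proof (rule Bochner_Integration.integrable_bound[OF Y])
    show "AE \<omega> in M. norm (?X \<omega>) \<le> norm (Y \<omega>)"
    proof (rule AE_I2)
      fix \<omega> assume "\<omega> \<in> space M"
      from le[OF this] nonneg[of \<omega>] show "norm (?X \<omega>) \<le> norm (Y \<omega>)"
        unfolding real_norm_def by linarith
    qed
  qed
  have total: "(\<Sum>z\<in>set w. real (count_list w z)) = real W"
    using sum_count_set[of w "set w"] len by (simp flip: of_nat_sum)
  have "expectation ?X \<le> expectation Y"
    using le by (intro integral_mono X Y)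
  \<comment> \<open>Adding back the diagonal \<open>z = y\<close> makes each inner sum
    \<open>W / 2 ^ L\<close>, whose \<open>W\<close> cancels the normalisation.\<close>
  also have "expectation Y \<le> (\<Sum>y\<in>set w. \<Sum>z\<in>set w. real (count_list w z) / 2 ^ L) / real W"
    unfolding EY by (intro divide_right_mono sum_mono sum_mono2) auto
  also have "\<dots> = real (card (set w)) / 2 ^ L"
    using W by (simp add: total flip: sum_divide_distrib)
  also have "\<dots> \<le> real W / 2 ^ L"
    using card_length[of w] len by (intro divide_right_mono) auto
  finally show "expectation ?X \<le> real W / 2 ^ L" .
qed

end

theorem theorem18:
  fixes M :: "'a measure" and h :: "'id \<Rightarrow> 'a \<Rightarrow> nat"
    and W L :: nat and \<epsilon> \<delta> \<epsilon>\<^sub>H :: real and stream w :: "'id list"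
  assumes "prob_space M"
    and "W \<ge> 1" and "0 < \<epsilon>" and "\<epsilon> < 1"
    and "real W * inverse \<epsilon> = 2 ^ L"
    and "length stream \<ge> W" and "w = last_items W stream"
    and "prob_space.uniform_fingerprints M L h"
    and "0 < \<delta>" and "\<delta> \<le> 1" and "\<epsilon>\<^sub>H = \<epsilon> * inverse \<delta>"
  shows "prob_space.solves_entropy_estimation M W \<epsilon>\<^sub>H \<delta> w
           (\<lambda>\<omega>. swamp_entropy W (\<lambda>y. h y \<omega>) w)"
proof -
  interpret prob_space M by fact
  let ?X = "\<lambda>\<omega>. window_entropy W w - swamp_entropy W (\<lambda>y. h y \<omega>) w"
  have W: "W > 0" and len: "length w = W"
    using assms(2,6,7) by (auto simp: last_items_def)
  \<comment> \<open>The choice of fingerprint length makes the bound on the mean error exactly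
    \<epsilon>.\<close>
  have \<epsilon>: "real W / 2 ^ L = \<epsilon>"
    using assms(3,5) W by (simp add: field_simps)
  have \<epsilon>\<^sub>H: "\<epsilon>\<^sub>H > 0" "\<epsilon> / \<epsilon>\<^sub>H = \<delta>"
    using assms(3,9,11) by (simp_all add: inverse_eq_divide)
  note E = expectation_entropy_deficit_le[OF assms(8) W len]
  \<comment> \<open>Markov's inequality applies because the deficit is nonnegative; the threshold is
    \<epsilon> divided by \<delta>, so the quotient is at most \<delta>.\<close>
  have "prob {\<omega> \<in> space M. \<epsilon>\<^sub>H \<le> ?X \<omega>} \<le> expectation ?X / \<epsilon>\<^sub>H"
    using swamp_entropy_le_window_entropy[OF W] \<epsilon>\<^sub>H
    by (intro integral_Markov_inequality_measure[OF E(1), where A = "{}"]) auto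
  also have "\<dots> \<le> \<delta>"
    using divide_right_mono[OF E(2), of \<epsilon>\<^sub>H] \<epsilon>\<^sub>H \<epsilon> by simp
  finally show ?thesis
    unfolding solves_entropy_estimation_def
    using swamp_entropy_measurable[OF uniform_fingerprints_measurable[OF assms(8)]]
      swamp_entropy_le_window_entropy[OF W] by auto
qed

end
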